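(* Let $G$ be a planar graph. Suppose that for every signature $\sigma$ of $G$, the signed graph $(G,\sigma)$ is $4$-colourable. Then for every $2$-list assignment $L$ of $G$, there is an $L$-colouring $\phi$ of $G$ such that for every colour $i$, the set $\phi^{-1}(i)=\{v\in V(G):\phi(v)=i\}$ induces a bipartite subgraph of $G$.
   Context: A signature of a graph $G$ is a mapping $\sigma: E(G)\to\{1,-1\}$, and the pair $(G,\sigma)$ is a signed graph. A $4$-colouring of a signed graph $(G,\sigma)$ is a mapping $f: V(G)\to\{1,-1,2,-2\}$ such that for every edge $e=xy$ of $G$, $f(x)\neq \sigma(e) f(y)$. A $2$-list assignment $L$ of $G$ assigns to each vertex $v$ a set $L(v)$ of exactly two colours; an $L$-colouring is a mapping $\phi$ on $V(G)$ with $\phi(v)\in L(v)$ for every vertex $v$ (no properness condition is imposed beyond what is stated in the claim). *)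

theory Defs
  imports "HOL-Analysis.Analysis"
begin

definition simple_graph :: "'v set \<Rightarrow> 'v set set \<Rightarrow> bool" where
  "simple_graph V E \<longleftrightarrow> finite V \<and> (\<forall>e\<in>E. e \<subseteq> V \<and> card e = 2)"

text \<open>Vertices are drawn as points of the plane and edges as simple arcs; an arc meets no vertex
  point other than its two ends, and two different arcs meet only in ends they share.\<close>

definition plane_drawing ::
  "'v set \<Rightarrow> 'v set set \<Rightarrow> ('v \<Rightarrow> real ^ 2) \<Rightarrow> ('v set \<Rightarrow> real \<Rightarrow> real ^ 2) \<Rightarrow> bool" where
  "plane_drawing V E p \<gamma> \<longleftrightarrow>
     inj_on p V \<and>
     (\<forall>e\<in>E. arc (\<gamma> e) \<and> {pathstart (\<gamma> e), pathfinish (\<gamma> e)} = p ` e \<and>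
             path_image (\<gamma> e) \<inter> p ` V = p ` e) \<and>
     (\<forall>e\<in>E. \<forall>e'\<in>E. e \<noteq> e' \<longrightarrow> path_image (\<gamma> e) \<inter> path_image (\<gamma> e') \<subseteq> p ` (e \<inter> e'))"

definition planar_graph :: "'v set \<Rightarrow> 'v set set \<Rightarrow> bool" where
  "planar_graph V E \<longleftrightarrow> simple_graph V E \<and> (\<exists>p \<gamma>. plane_drawing V E p \<gamma>)"

definition is_signature :: "'v set set \<Rightarrow> ('v set \<Rightarrow> int) \<Rightarrow> bool" where
  "is_signature E \<sigma> \<longleftrightarrow> (\<forall>e\<in>E. \<sigma> e \<in> {1, -1})"

definition signed_4_colouring ::
  "'v set \<Rightarrow> 'v set set \<Rightarrow> ('v set \<Rightarrow> int) \<Rightarrow> ('v \<Rightarrow> int) \<Rightarrow> bool" where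
  "signed_4_colouring V E \<sigma> f \<longleftrightarrow>
     (\<forall>v\<in>V. f v \<in> {1, -1, 2, -2}) \<and>
     (\<forall>x y. {x, y} \<in> E \<longrightarrow> f x \<noteq> \<sigma> {x, y} * f y)"

definition signed_4_colourable :: "'v set \<Rightarrow> 'v set set \<Rightarrow> ('v set \<Rightarrow> int) \<Rightarrow> bool" where
  "signed_4_colourable V E \<sigma> \<longleftrightarrow> (\<exists>f. signed_4_colouring V E \<sigma> f)"

definition two_list_assignment :: "'v set \<Rightarrow> ('v \<Rightarrow> 'c set) \<Rightarrow> bool" where
  "two_list_assignment V L \<longleftrightarrow> (\<forall>v\<in>V. card (L v) = 2)"

definition list_colouring :: "'v set \<Rightarrow> ('v \<Rightarrow> 'c set) \<Rightarrow> ('v \<Rightarrow> 'c) \<Rightarrow> bool" where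
  "list_colouring V L \<phi> \<longleftrightarrow> (\<forall>v\<in>V. \<phi> v \<in> L v)"

definition induced_edges :: "'v set set \<Rightarrow> 'v set \<Rightarrow> 'v set set" where
  "induced_edges E S = {e \<in> E. e \<subseteq> S}"

definition bipartite :: "'v set \<Rightarrow> 'v set set \<Rightarrow> bool" where
  "bipartite V E \<longleftrightarrow>
     (\<exists>A B. A \<union> B = V \<and> A \<inter> B = {} \<and> (\<forall>e\<in>E. \<exists>a\<in>A. \<exists>b\<in>B. e = {a, b}))"

end

theory Submission
  imports Defs
begin

text \<open>Write \<open>L v = {a v, b v}\<close> and give an edge \<open>xy\<close> the sign \<open>1\<close> if \<open>a x = a y\<close> or \<open>b x = b y\<close>,
  and \<open>-1\<close> otherwise. From a 4-colouring \<open>f\<close> of the resulting signed graph, let \<open>\<phi> v\<close> be \<open>a v\<close> or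
  \<open>b v\<close> according to the sign of \<open>f v\<close>. If the ends of \<open>xy\<close> receive the same colour, then the sign
  of \<open>xy\<close> is the product of the signs of \<open>f x\<close> and \<open>f y\<close>, so \<open>\<bar>f\<bar>\<close> takes both values
  \<open>1\<close> and \<open>2\<close> on \<open>xy\<close>. Hence \<open>\<bar>f\<bar>\<close> 2-colours each colour class of \<open>\<phi>\<close>.\<close>

lemma two_list_assignment_pair:
  assumes "two_list_assignment V L"
  obtains a b where "\<And>v. v \<in> V \<Longrightarrow> L v = {a v, b v}" "\<And>v. v \<in> V \<Longrightarrow> a v \<noteq> b v"
proof -
  have "\<forall>v\<in>V. \<exists>a b. L v = {a, b} \<and> a \<noteq> b"
    using assms by (auto simp: two_list_assignment_def card_2_iff)
  then show thesis
    using that by metis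
qed

text \<open>Injectivity on an edge says that its ends differ under both \<open>a\<close> and
  \<open>b\<close>; in this form the sign needs no order of the ends.\<close>

definition list_signature :: "('v \<Rightarrow> 'c) \<Rightarrow> ('v \<Rightarrow> 'c) \<Rightarrow> 'v set \<Rightarrow> int" where
  "list_signature a b e = (if inj_on a e \<and> inj_on b e then -1 else 1)"

lemma is_signature_list_signature: "is_signature E (list_signature a b)"
  by (simp add: is_signature_def list_signature_def)

text \<open>If \<open>f x\<close> and \<open>f y\<close> have equal signs, \<open>mono\<close> gives
  \<open>a x = a y\<close> or \<open>b x = b y\<close>, so the edge has sign 1. If the signs differ,
  say \<open>a x = b y\<close>; then \<open>ab\<close> excludes both equalities, and the edge has
  sign -1. Either way \<open>neq\<close> forbids equal absolute values.\<close>

lemma abs_neq_on_monochromatic_edge: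
  fixes f :: "'v \<Rightarrow> int"
  assumes col: "signed_4_colouring V E (list_signature a b) f"
    and edge: "{x, y} \<in> E" "x \<noteq> y"
    and V: "x \<in> V" "y \<in> V"
    and ab: "a x \<noteq> b x" "a y \<noteq> b y"
    and mono: "(if f x > 0 then a x else b x) = (if f y > 0 then a y else b y)"
  shows "\<bar>f x\<bar> \<noteq> \<bar>f y\<bar>"
proof -
  have neq: "f x \<noteq> list_signature a b {x, y} * f y"
    using col edge by (auto simp: signed_4_colouring_def)
  have sig: "list_signature a b {x, y} = (if a x = a y \<or> b x = b y then 1 else -1)"
    using edge by (auto simp: list_signature_def)
  have "f x \<in> {1, -1, 2, -2}" "f y \<in> {1, -1, 2, -2}"
    using col V by (auto simp: signed_4_colouring_def)
  then show ?thesis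
    using neq sig mono ab by (auto split: if_splits)
qed

theorem theorem3:
  fixes V :: "'v set" and E :: "'v set set"
  assumes "planar_graph V E"
    and "\<forall>\<sigma>. is_signature E \<sigma> \<longrightarrow> signed_4_colourable V E \<sigma>"
  shows "\<forall>L :: 'v \<Rightarrow> 'c set. two_list_assignment V L \<longrightarrow>
           (\<exists>\<phi>. list_colouring V L \<phi> \<and>
             (\<forall>i. bipartite {v \<in> V. \<phi> v = i} (induced_edges E {v \<in> V. \<phi> v = i})))"
proof (intro allI impI)
  fix L :: "'v \<Rightarrow> 'c set"
  assume "two_list_assignment V L"
  then obtain a b where L: "\<And>v. v \<in> V \<Longrightarrow> L v = {a v, b v}" and ab: "\<And>v. v \<in> V \<Longrightarrow> a v \<noteq> b v"
    by (rule two_list_assignment_pair) blast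
  obtain f where f: "signed_4_colouring V E (list_signature a b) f"
    using assms(2) is_signature_list_signature unfolding signed_4_colourable_def by blast
  define \<phi> where "\<phi> v = (if f v > 0 then a v else b v)" for v
  have "bipartite {v \<in> V. \<phi> v = i} (induced_edges E {v \<in> V. \<phi> v = i})" for i
  proof -
    define S where "S = {v \<in> V. \<phi> v = i}"
    define A where "A = {v \<in> S. \<bar>f v\<bar> = 1}"
    define B where "B = {v \<in> S. \<bar>f v\<bar> = 2}"
    have abs_f: "\<bar>f v\<bar> = 1 \<or> \<bar>f v\<bar> = 2" if "v \<in> S" for v
      using that f by (auto simp: S_def signed_4_colouring_def)
    have "\<exists>u\<in>A. \<exists>w\<in>B. e = {u, w}" if "e \<in> induced_edges E S" for e
    proof -
      have e: "e \<in> E" "e \<subseteq> S"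
        using that by (auto simp: induced_edges_def)
      then have "card e = 2"
        using assms(1) by (auto simp: planar_graph_def simple_graph_def)
      then obtain x y where xy: "e = {x, y}" "x \<noteq> y"
        by (auto simp: card_2_iff)
      then have "x \<in> S" "y \<in> S"
        using e by auto
      \<comment> \<open>Both ends lie in \<open>S\<close>, so \<open>\<phi>\<close> equals
        \<open>i\<close> at each of them: this is \<open>mono\<close>.\<close>
      then have "\<bar>f x\<bar> \<noteq> \<bar>f y\<bar>"
        using e(1) xy ab by (intro abs_neq_on_monochromatic_edge[OF f]) (auto simp: S_def \<phi>_def)
      then have "x \<in> A \<and> y \<in> B \<or> y \<in> A \<and> x \<in> B"
        using \<open>x \<in> S\<close> \<open>y \<in> S\<close> abs_f[of x] abs_f[of y] by (auto simp: A_def B_def)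
      \<comment> \<open>In the second case the edge is read as \<open>{y, x}\<close>, with its end
        in \<open>A\<close> first.\<close>
      then show ?thesis
        using xy(1) insert_commute by blast
    qed
    moreover have "A \<union> B = S" "A \<inter> B = {}"
      using abs_f by (auto simp: A_def B_def)
    ultimately show ?thesis
      unfolding bipartite_def S_def[symmetric] by blast
  qed
  moreover have "list_colouring V L \<phi>"
    by (simp add: list_colouring_def L \<phi>_def)
  ultimately show "\<exists>\<phi>. list_colouring V L \<phi> \<and>
      (\<forall>i. bipartite {v \<in> V. \<phi> v = i} (induced_edges E {v \<in> V. \<phi> v = i}))"
    by blast
qed

end
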